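(* Let $\Omega\subset\mathbb R^3$ be an open set and let $f:\Omega\times\mathbb R\to\mathbb R$ satisfy (H2) and (H5) (stated in the context), with constants $C>0$, $2\le\gamma<3$ and function $D$. Then for every $0<\epsilon\le1$ and (almost every) $x\in\Omega$, $$\partial_uf(x,0)\le\frac2\epsilon D(x)+\frac\epsilon2C(1+\epsilon^\gamma).$$
   Context: $L^\sigma_{\rm u}(\mathbb R^3)$ is the set of measurable $\omega:\mathbb R^3\to\mathbb R$ with $\sup_{y\in\mathbb R^3}(\int_{B(y)}|\omega|^\sigma dx)^{1/\sigma}<\infty$, where $B(y)$ is the open unit cube centered at $y$. Functions on $\Omega$ are extended by zero when needed. (H2): $f(\cdot,u)$ is measurable for every $u\in\mathbb R$, and $f(x,\cdot)$ is $C^2$ for a.e. $x\in\Omega$; $f(\cdot,0)\in L^q(\Omega)$ with $6/5<q\le2$; $\partial_uf(\cdot,0)\in L^\sigma_{\rm u}(\mathbb R^3)$ with $\sigma>3/2$; there are constants $C>0$ and $2\le\gamma<3$ with $|\partial_{uu}f(x,u)|\le C(1+|u|^\gamma)$. (H5): there exists a nonnegative function $D\in L^q(\Omega)$, $3/2<q\le2$, such that $f(x,u)u\le D(x)|u|$ for all $(x,u)\in\Omega\times\mathbb R$. *)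

theory Defs
  imports "HOL-Analysis.Analysis"
begin

text \<open>
  Measurable means Lebesgue measurable. Functions on a set \<open>\<Omega>\<close> are total functions
  of which only the values on \<open>\<Omega>\<close> are used.
\<close>

definition Lebesgue_space :: "real \<Rightarrow> 'a::euclidean_space set \<Rightarrow> ('a \<Rightarrow> real) set" where
  "Lebesgue_space p \<Omega> =
     {g \<in> borel_measurable (lebesgue_on \<Omega>). integrable (lebesgue_on \<Omega>) (\<lambda>x. \<bar>g x\<bar> powr p)}"

definition unit_cube :: "real^3 \<Rightarrow> (real^3) set" where
  "unit_cube y = {x. \<forall>i. \<bar>x $ i - y $ i\<bar> < 1/2}"

text \<open>
  The Bochner integral of a non-integrable function is 0, so integrability on each cube
  has to be demanded separately.
\<close>
definition uniform_Lebesgue_space :: "real \<Rightarrow> (real^3 \<Rightarrow> real) set" where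
  "uniform_Lebesgue_space \<sigma> =
     {\<omega> \<in> borel_measurable lebesgue.
        (\<forall>y. integrable (lebesgue_on (unit_cube y)) (\<lambda>x. \<bar>\<omega> x\<bar> powr \<sigma>)) \<and>
        bdd_above (range (\<lambda>y.
          (integral\<^sup>L (lebesgue_on (unit_cube y)) (\<lambda>x. \<bar>\<omega> x\<bar> powr \<sigma>)) powr (1 / \<sigma>)))}"

definition C2 :: "(real \<Rightarrow> real) \<Rightarrow> bool" where
  "C2 g \<longleftrightarrow> g differentiable_on UNIV \<and> deriv g differentiable_on UNIV \<and>
           continuous_on UNIV (deriv (deriv g))"

text \<open>
  The partial derivatives in \<open>u\<close> exist only for almost every \<open>x\<close>, hence the growth bound
  is imposed for almost every \<open>x\<close>; the values of \<open>deriv (f x) 0\<close> on the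
  exceptional null set do not affect membership in the uniform Lebesgue space.
  The indicator implements extension by zero.
\<close>
definition H2 :: "(real^3) set \<Rightarrow> (real^3 \<Rightarrow> real \<Rightarrow> real) \<Rightarrow> real \<Rightarrow> real \<Rightarrow> real \<Rightarrow> real \<Rightarrow> bool" where
  "H2 \<Omega> f q \<sigma> C \<gamma> \<longleftrightarrow>
     (\<forall>u. (\<lambda>x. f x u) \<in> borel_measurable (lebesgue_on \<Omega>)) \<and>
     (AE x in lebesgue_on \<Omega>. C2 (f x)) \<and>
     6/5 < q \<and> q \<le> 2 \<and> (\<lambda>x. f x 0) \<in> Lebesgue_space q \<Omega> \<and>
     3/2 < \<sigma> \<and> (\<lambda>x. indicator \<Omega> x * deriv (f x) 0) \<in> uniform_Lebesgue_space \<sigma> \<and>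
     0 < C \<and> 2 \<le> \<gamma> \<and> \<gamma> < 3 \<and>
     (AE x in lebesgue_on \<Omega>. \<forall>u. \<bar>deriv (deriv (f x)) u\<bar> \<le> C * (1 + \<bar>u\<bar> powr \<gamma>))"

definition H5 :: "(real^3) set \<Rightarrow> (real^3 \<Rightarrow> real \<Rightarrow> real) \<Rightarrow> real \<Rightarrow> (real^3 \<Rightarrow> real) \<Rightarrow> bool" where
  "H5 \<Omega> f q D \<longleftrightarrow>
     3/2 < q \<and> q \<le> 2 \<and> D \<in> Lebesgue_space q \<Omega> \<and> (\<forall>x\<in>\<Omega>. 0 \<le> D x) \<and>
     (\<forall>x\<in>\<Omega>. \<forall>u. f x u * u \<le> D x * \<bar>u\<bar>)"

end

theory Submission
  imports Defs
begin

text \<open>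
  Fix a point \<open>x\<close> and write \<open>g = f x\<close>. Dividing the sign condition by \<open>\<bar>u\<bar>\<close> bounds \<open>g\<close> on one side
  only: \<open>g u \<le> D x\<close> for \<open>u > 0\<close> and \<open>g u \<ge> - D x\<close> for \<open>u < 0\<close>. By continuity the second bound
  persists at \<open>u = 0\<close>, so \<open>g\<close> can rise by at most \<open>2 D x\<close> between \<open>0\<close> and \<open>\<epsilon>\<close>. Taylor's formula
  \<open>g \<epsilon> = g 0 + g'(0) \<epsilon> + g''(\<xi>) \<epsilon>\<^sup>2 / 2\<close> compares this rise with \<open>g'(0) \<epsilon>\<close>, up to an error
  governed by the growth of the second derivative on \<open>(0, \<epsilon>)\<close>; division by \<open>\<epsilon>\<close> gives the estimate.
  The measure theory enters only through the null set off which \<open>g\<close> is twice differentiable and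
  its second derivative satisfies the growth bound.
\<close>

lemma sign_condition_at_zero:
  fixes g :: "real \<Rightarrow> real"
  assumes "isCont g 0" and "\<And>u. u < 0 \<Longrightarrow> g u * u \<le> d * \<bar>u\<bar>"
  shows "- d \<le> g 0"
proof (rule tendsto_lowerbound)
  show "(g \<longlongrightarrow> g 0) (at_left 0)"
    using assms(1) filterlim_at_split isCont_def by blast
  have "- d \<le> g u" if "u < 0" for u
  proof -
    have "(- d) * (- u) \<le> g u * (- u)"
      using assms(2)[OF that] that by simp
    then show ?thesis
      by (rule mult_right_le_imp_le) (use that in simp)
  qed
  then show "\<forall>\<^sub>F u in at_left 0. - d \<le> g u"
    by (auto simp: eventually_at_filter)
qed simp

lemma C2_Taylor_second_order:
  assumes "C2 g" and "0 < e"
  obtains t where "0 < t" "t < e"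
    and "g e = g 0 + deriv g 0 * e + deriv (deriv g) t / 2 * e\<^sup>2"
proof -
  have derivs: "(g has_real_derivative deriv g t) (at t)"
    "(deriv g has_real_derivative deriv (deriv g) t) (at t)" for t
    using assms(1)
    by (auto simp: C2_def differentiable_on_def DERIV_deriv_iff_real_differentiable)
  have "\<forall>m t. m < 2 \<and> 0 \<le> t \<and> t \<le> e \<longrightarrow>
      ((deriv ^^ m) g has_real_derivative (deriv ^^ Suc m) g t) (at t)"
    using derivs by (auto simp: less_2_cases_iff)
  from Maclaurin[OF assms(2), of 2 "\<lambda>m. (deriv ^^ m) g" g] this
  show ?thesis
    using that by (force simp: numeral_2_eq_2)
qed

text \<open>
  The bound on the second derivative is required only on \<open>(0, e)\<close>, so that a growth bound increasing
  in \<open>\<bar>u\<bar>\<close> may be replaced by its value at \<open>e\<close>.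
\<close>
lemma deriv_zero_le_of_sign_condition:
  assumes "C2 g" and "0 < e"
    and sign: "\<And>u. g u * u \<le> d * \<bar>u\<bar>"
    and bound: "\<And>t. 0 < t \<Longrightarrow> t < e \<Longrightarrow> \<bar>deriv (deriv g) t\<bar> \<le> M"
  shows "deriv g 0 \<le> 2 / e * d + e / 2 * M"
proof -
  obtain t where t: "0 < t" "t < e"
    and taylor: "g e = g 0 + deriv g 0 * e + deriv (deriv g) t / 2 * e\<^sup>2"
    using C2_Taylor_second_order[OF assms(1,2)] .
  have "isCont g 0"
    using assms(1) unfolding C2_def
    by (meson differentiable_imp_continuous_on continuous_on_eq_continuous_at open_UNIV UNIV_I)
  then have "- d \<le> g 0"
    using sign by (intro sign_condition_at_zero)
  moreover have "g e \<le> d"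
    using sign[of e] \<open>0 < e\<close> by (simp add: mult_le_cancel_right)
  moreover have "- M / 2 * e\<^sup>2 \<le> deriv (deriv g) t / 2 * e\<^sup>2"
    using bound[OF t] by (intro mult_right_mono) auto
  ultimately have "deriv g 0 * e \<le> 2 * d + M / 2 * e\<^sup>2"
    using taylor by linarith
  also have "\<dots> = (2 / e * d + e / 2 * M) * e"
    using \<open>0 < e\<close> by (simp add: field_simps power2_eq_square)
  finally show ?thesis
    using \<open>0 < e\<close> by (simp only: mult_le_cancel_right_pos)
qed

theorem theorem6p4:
  fixes \<Omega> :: "(real^3) set" and f :: "real^3 \<Rightarrow> real \<Rightarrow> real" and D :: "real^3 \<Rightarrow> real"
    and q q' \<sigma> C \<gamma> \<epsilon> :: real
  assumes "open \<Omega>"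
    and "H2 \<Omega> f q \<sigma> C \<gamma>"
    and "H5 \<Omega> f q' D"
    and "0 < \<epsilon>" and "\<epsilon> \<le> 1"
  shows "AE x in lebesgue_on \<Omega>.
    deriv (f x) 0 \<le> 2 / \<epsilon> * D x + \<epsilon> / 2 * C * (1 + \<epsilon> powr \<gamma>)"
proof -
  have C2: "AE x in lebesgue_on \<Omega>. C2 (f x)"
    and growth: "AE x in lebesgue_on \<Omega>. \<forall>u. \<bar>deriv (deriv (f x)) u\<bar> \<le> C * (1 + \<bar>u\<bar> powr \<gamma>)"
    and "0 < C" "2 \<le> \<gamma>"
    using assms(2) by (auto simp: H2_def)
  have sign: "f x u * u \<le> D x * \<bar>u\<bar>" if "x \<in> \<Omega>" for x u
    using assms(3) that by (auto simp: H5_def)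
  show ?thesis
    using C2 growth AE_space
  proof eventually_elim
    case (elim x)
    have "x \<in> \<Omega>"
      using elim(3) by simp
    have "\<bar>deriv (deriv (f x)) t\<bar> \<le> C * (1 + \<epsilon> powr \<gamma>)" if "0 < t" "t < \<epsilon>" for t
    proof -
      have "\<bar>deriv (deriv (f x)) t\<bar> \<le> C * (1 + \<bar>t\<bar> powr \<gamma>)"
        using elim(2) by blast
      also have "\<dots> \<le> C * (1 + \<epsilon> powr \<gamma>)"
        using that \<open>0 < C\<close> \<open>2 \<le> \<gamma>\<close>
        by (intro mult_left_mono add_left_mono powr_mono2) auto
      finally show ?thesis .
    qed
    then have "deriv (f x) 0 \<le> 2 / \<epsilon> * D x + \<epsilon> / 2 * (C * (1 + \<epsilon> powr \<gamma>))"
      using elim(1) \<open>0 < \<epsilon>\<close> sign[OF \<open>x \<in> \<Omega>\<close>] by (intro deriv_zero_le_of_sign_condition)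
    then show ?case
      by (simp only: mult.assoc)
  qed
qed

end
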